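(* Let $d\ge1$ and let $\mathcal{D}$ be a family of measurable subsets of $[0,1]^d$ with $\emptyset,[0,1]^d\in\mathcal{D}$ which is closed under intersections (i.e. $D_1,D_2\in\mathcal{D}$ implies $D_1\cap D_2\in\mathcal{D}$). Let $\sigma\ge3$ be a real number and, for $f\in\mathcal{V}(\mathcal{D})$, put $\|f\|=\|f\|_\infty+\sigma V_{\mathcal{D}}(f)$. Then $(\mathcal{V}(\mathcal{D}),\|\cdot\|)$ is a commutative (real) Banach algebra with respect to pointwise multiplication.
   Context: "Measurable" refers to a fixed $\sigma$-algebra on $[0,1]^d$ (e.g. Borel). $\|f\|_\infty=|f|_\infty=\sup_{\mathbf{x}\in[0,1]^d}|f(\mathbf{x})|$. A Banach algebra is a complete normed algebra with submultiplicative norm ($\|fg\|\le\|f\|\,\|g\|$). $\mathcal{D}$-variation. $\mathcal{S}(\mathcal{D})$ is the real vector space of functions $\sum_{i=1}^m\alpha_i\mathds{1}_{A_i}$ on $[0,1]^d$ with $m\in\mathbb{N}$, $\alpha_i\in\mathbb{R}$, $A_i\in\mathcal{D}$ ($\mathds{1}_A$ is the indicator function of $A$). A set $A\subseteq[0,1]^d$ is an algebraic sum of sets in $\mathcal{D}$ if $\mathds{1}_A=\sum_{i=1}^n\mathds{1}_{A_i}-\sum_{i=n+1}^m\mathds{1}_{A_i}$ for some $A_1,\dots,A_m\in\mathcal{D}$. For such $A$ with $A\ne\emptyset$, $A\neq[0,1]^d$, the Harman complexity $h_{\mathcal{D}}(A)$ is the minimal $m$ such that $\mathds{1}_A=\sum_{i=1}^n\mathds{1}_{A_i}-\sum_{i=n+1}^m\mathds{1}_{A_i}$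 for some $n\in\{0,\dots,m\}$ and sets $A_i$ with, for each $i$, $A_i\in\mathcal{D}$ or $[0,1]^d\setminus A_i\in\mathcal{D}$; also $h_{\mathcal{D}}(\emptyset)=h_{\mathcal{D}}([0,1]^d)=0$. For $f\in\mathcal{S}(\mathcal{D})$ put $$V_{\mathcal{S},\mathcal{D}}(f)=\inf\Big\{\sum_{i=1}^m|\alpha_i|h_{\mathcal{D}}(A_i)\ \Big|\ f=\sum_{i=1}^m\alpha_i\mathds{1}_{A_i},\ \alpha_i\in\mathbb{R},\ A_i\in\mathcal{D}\Big\}.$$ Let $\mathcal{V}_\infty(\mathcal{D})$ be the set of measurable $f:[0,1]^d\to\mathbb{R}$ that are limits in the supremum norm of sequences in $\mathcal{S}(\mathcal{D})$. For $f\in\mathcal{V}_\infty(\mathcal{D})$, $$V_{\mathcal{D}}(f)=\inf\big\{\liminf_i V_{\mathcal{S},\mathcal{D}}(f_i)\ \big|\ f_i\in\mathcal{S}(\mathcal{D}),\ \lim_i|f-f_i|_\infty=0\big\},$$ and $V_{\mathcal{D}}(f)=\infty$ if $f\notin\mathcal{V}_\infty(\mathcal{D})$. Finally $\mathcal{V}(\mathcal{D})=\{f\in\mathcal{V}_\infty(\mathcal{D})\mid V_{\mathcal{D}}(f)<\infty\}$ is the space of functions of bounded $\mathcal{D}$-variation. *)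

theory Defs
  imports "HOL-Analysis.Analysis"
begin

section \<open>Commutative real Banach algebras on a carrier set\<close>

text \<open>
  The library has normed algebras only as type classes (\<^class>\<open>real_normed_algebra\<close>,
  \<^class>\<open>banach\<close>). The locale below relativises them to a carrier set with explicit operations.
  As in those classes, no unit is required.
\<close>

locale commutative_banach_algebra =
  fixes carrier :: "'a set"
    and add :: "'a \<Rightarrow> 'a \<Rightarrow> 'a"
    and zero :: 'a
    and scale :: "real \<Rightarrow> 'a \<Rightarrow> 'a"
    and mult :: "'a \<Rightarrow> 'a \<Rightarrow> 'a"
    and nrm :: "'a \<Rightarrow> real"
  assumes zero_closed: "zero \<in> carrier"
    and add_closed: "\<lbrakk>x \<in> carrier; y \<in> carrier\<rbrakk> \<Longrightarrow> add x y \<in> carrier"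
    and scale_closed: "x \<in> carrier \<Longrightarrow> scale a x \<in> carrier"
    and mult_closed: "\<lbrakk>x \<in> carrier; y \<in> carrier\<rbrakk> \<Longrightarrow> mult x y \<in> carrier"
    and add_assoc: "\<lbrakk>x \<in> carrier; y \<in> carrier; z \<in> carrier\<rbrakk>
          \<Longrightarrow> add (add x y) z = add x (add y z)"
    and add_commute: "\<lbrakk>x \<in> carrier; y \<in> carrier\<rbrakk> \<Longrightarrow> add x y = add y x"
    and add_zero: "x \<in> carrier \<Longrightarrow> add x zero = x"
    and add_inverse: "x \<in> carrier \<Longrightarrow> \<exists>y\<in>carrier. add x y = zero"
    and scale_add_right: "\<lbrakk>x \<in> carrier; y \<in> carrier\<rbrakk>
          \<Longrightarrow> scale a (add x y) = add (scale a x) (scale a y)"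
    and scale_add_left: "x \<in> carrier \<Longrightarrow> scale (a + b) x = add (scale a x) (scale b x)"
    and scale_scale: "x \<in> carrier \<Longrightarrow> scale a (scale b x) = scale (a * b) x"
    and scale_one: "x \<in> carrier \<Longrightarrow> scale 1 x = x"
    and mult_assoc: "\<lbrakk>x \<in> carrier; y \<in> carrier; z \<in> carrier\<rbrakk>
          \<Longrightarrow> mult (mult x y) z = mult x (mult y z)"
    and mult_commute: "\<lbrakk>x \<in> carrier; y \<in> carrier\<rbrakk> \<Longrightarrow> mult x y = mult y x"
    and mult_add_left: "\<lbrakk>x \<in> carrier; y \<in> carrier; z \<in> carrier\<rbrakk>
          \<Longrightarrow> mult (add x y) z = add (mult x z) (mult y z)"
    and mult_scale_left: "\<lbrakk>x \<in> carrier; y \<in> carrier\<rbrakk>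
          \<Longrightarrow> mult (scale a x) y = scale a (mult x y)"
    and nrm_nonneg: "x \<in> carrier \<Longrightarrow> 0 \<le> nrm x"
    and nrm_eq_zero_iff: "x \<in> carrier \<Longrightarrow> nrm x = 0 \<longleftrightarrow> x = zero"
    and nrm_triangle: "\<lbrakk>x \<in> carrier; y \<in> carrier\<rbrakk> \<Longrightarrow> nrm (add x y) \<le> nrm x + nrm y"
    and nrm_scale: "x \<in> carrier \<Longrightarrow> nrm (scale a x) = \<bar>a\<bar> * nrm x"
    and nrm_mult: "\<lbrakk>x \<in> carrier; y \<in> carrier\<rbrakk> \<Longrightarrow> nrm (mult x y) \<le> nrm x * nrm y"
    and complete: "Metric_space.mcomplete carrier (\<lambda>x y. nrm (add x (scale (- 1) y)))"


section \<open>Functions of bounded variation with respect to a family of sets\<close>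

text \<open>
  A function $[0,1]^d \to \mathbb{R}$ is represented by its extension by zero to the whole of
  \<^typ>\<open>real^'n\<close>, so that equality of functions on the cube is equality in HOL. The indicator
  function of a subset of the cube already has this form.
\<close>

definition unit_cube :: "(real^'n) set" where
  "unit_cube = cbox 0 1"

text \<open>
  Suprema and variations are extended reals, so that unbounded functions and infima over the empty
  set get the value \<^term>\<open>\<infinity> :: ereal\<close>, not an unspecified real number.
\<close>

definition sup_norm :: "(real^'n \<Rightarrow> real) \<Rightarrow> ereal" where
  "sup_norm f = (SUP x\<in>unit_cube. ereal \<bar>f x\<bar>)"

definition simple_functions :: "(real^'n) set set \<Rightarrow> (real^'n \<Rightarrow> real) set" where
  "simple_functions D =
     {f. \<exists>(m::nat) \<alpha> A. (\<forall>i<m. A i \<in> D) \<and> f = (\<lambda>x. \<Sum>i<m. \<alpha> i * indicator (A i) x)}"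

text \<open>
  Meaningful only for algebraic sums of sets in \<open>D\<close>; otherwise there need not be any representation,
  and the value of \<open>LEAST\<close> is unspecified. The variation below uses it only on members of \<open>D\<close>.
\<close>

definition harman_complexity :: "(real^'n) set set \<Rightarrow> (real^'n) set \<Rightarrow> nat" where
  "harman_complexity D A =
     (if A = {} \<or> A = unit_cube then 0
      else LEAST m. \<exists>n\<le>m. \<exists>B :: nat \<Rightarrow> (real^'n) set.
        (\<forall>i<m. B i \<subseteq> unit_cube \<and> (B i \<in> D \<or> unit_cube - B i \<in> D)) \<and>
        (indicator A :: real^'n \<Rightarrow> real) =
          (\<lambda>x. (\<Sum>i<n. indicator (B i) x) - (\<Sum>i=n..<m. indicator (B i) x)))"

definition simple_variation :: "(real^'n) set set \<Rightarrow> (real^'n \<Rightarrow> real) \<Rightarrow> ereal" where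
  "simple_variation D f =
     Inf {ereal (\<Sum>i<m. \<bar>\<alpha> i\<bar> * real (harman_complexity D (A i))) | (m::nat) \<alpha> A.
            (\<forall>i<m. A i \<in> D) \<and> f = (\<lambda>x. \<Sum>i<m. \<alpha> i * indicator (A i) x)}"

text \<open>
  The measure \<open>M\<close> only serves to carry the fixed $\sigma$-algebra on the cube, \<^term>\<open>sets M\<close>;
  its values are irrelevant.
\<close>

definition uniform_limits ::
    "(real^'n) measure \<Rightarrow> (real^'n) set set \<Rightarrow> (real^'n \<Rightarrow> real) set" where
  "uniform_limits M D =
     {f \<in> borel_measurable M. (\<forall>x. x \<notin> unit_cube \<longrightarrow> f x = 0) \<and>
        (\<exists>F :: nat \<Rightarrow> real^'n \<Rightarrow> real. (\<forall>i. F i \<in> simple_functions D) \<and>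
           (\<lambda>i. sup_norm (\<lambda>x. f x - F i x)) \<longlonglongrightarrow> 0)}"

definition variation ::
    "(real^'n) measure \<Rightarrow> (real^'n) set set \<Rightarrow> (real^'n \<Rightarrow> real) \<Rightarrow> ereal" where
  "variation M D f =
     (if f \<in> uniform_limits M D then
        Inf {liminf (\<lambda>i. simple_variation D (F i)) | F :: nat \<Rightarrow> real^'n \<Rightarrow> real.
               (\<forall>i. F i \<in> simple_functions D) \<and>
               (\<lambda>i. sup_norm (\<lambda>x. f x - F i x)) \<longlonglongrightarrow> 0}
      else \<infinity>)"

definition bounded_variation ::
    "(real^'n) measure \<Rightarrow> (real^'n) set set \<Rightarrow> (real^'n \<Rightarrow> real) set" where
  "bounded_variation M D = {f \<in> uniform_limits M D. variation M D f < \<infinity>}"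

text \<open>On \<^const>\<open>bounded_variation\<close> both summands are finite.\<close>

definition variation_norm ::
    "real \<Rightarrow> (real^'n) measure \<Rightarrow> (real^'n) set set \<Rightarrow> (real^'n \<Rightarrow> real) \<Rightarrow> real" where
  "variation_norm \<sigma> M D f = real_of_ereal (sup_norm f) + \<sigma> * real_of_ereal (variation M D f)"

end

theory Submission
  imports Defs
begin

text \<open>
  For a nontrivial \<open>A \<in> D\<close> the Harman complexity is \<open>1\<close>, because \<open>A\<close> represents itself, and for the
  empty set and the cube it is \<open>0\<close>. The variation of a simple function is therefore the infimum of
  $\sum_i |\alpha_i|$ over all ways to write it as a constant plus
  $h = \sum_i \alpha_i 1_{A_i}$, the constant being free of charge. Consequently
  a measurable \<open>f\<close> supported on the cube has variation at most \<open>c\<close> exactly if, for each \<open>e > 0\<close>, it is within \<open>e\<close> of some \<open>a + h\<close> of cost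
  at most \<open>c + e\<close> (lemmas \<open>variation_finite\<close> and \<open>variation_leI\<close>). All the properties of the variation
  are read off from this description. Sums and scalar multiples are immediate, and so is lower
  semicontinuity under uniform limits (\<open>variation_at_most_lsc\<close>), which yields completeness: the
  uniform limit \<open>f\<close> of a Cauchy sequence \<open>F\<close> satisfies
  $V(f - F_n) \le \sup_{m \ge n} V(F_m - F_n)$.

  The family \<open>D\<close> is closed under intersections, so the product of two combinations of costs \<open>c\<close> and
  \<open>d\<close> is a combination of cost \<open>c * d\<close>. Multiplying $f \approx a + h$ and $g \approx b + k$ gives
  $fg \approx ab + ak + bh + hk$. A combination of cost \<open>c\<close> is bounded by \<open>c\<close>, so
  $|a| \le \|f\|_\infty + V(f)$ and $|b| \le \|g\|_\infty + V(g)$ up to small errors, and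
  \[ V(fg) \le \|f\|_\infty V(g) + \|g\|_\infty V(f) + 3 V(f) V(g). \]
  Expanding the product of the norms, one sees that this makes the norm submultiplicative as soon as
  $3 \sigma \le \sigma^2$.
\<close>

section \<open>Combinations of indicator functions and their cost\<close>

text \<open>
  \<open>combination D c h\<close> is the relation $h = \sum_i \alpha_i 1_{A_i}$ with $A_i \in D$ and
  $\sum_i |\alpha_i| \le c$. Building the sums term by term lets the closure properties be
  proved by rule induction, without reindexing.
\<close>

inductive combination :: "(real^'n) set set \<Rightarrow> real \<Rightarrow> (real^'n \<Rightarrow> real) \<Rightarrow> bool"
  for D where
  zero: "0 \<le> c \<Longrightarrow> combination D c (\<lambda>x. 0)"
| add_term: "combination D c h \<Longrightarrow> A \<in> D \<Longrightarrow>
    combination D (c + \<bar>\<alpha>\<bar>) (\<lambda>x. h x + \<alpha> * indicator A x)"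

lemma combination_cost_nonneg: "combination D c h \<Longrightarrow> 0 \<le> c"
  by (induction rule: combination.induct) auto

lemma combination_bound: "combination D c h \<Longrightarrow> \<bar>h x\<bar> \<le> c"
proof (induction rule: combination.induct)
  case (add_term c h A \<alpha>)
  have "\<bar>\<alpha> * indicator A x\<bar> \<le> \<bar>\<alpha>\<bar>"
    by (auto simp: indicator_def)
  then show ?case
    using add_term.IH by linarith
qed auto

lemma combination_mono: "combination D c h \<Longrightarrow> c \<le> d \<Longrightarrow> combination D d h"
proof (induction arbitrary: d rule: combination.induct)
  case (zero c)
  then show ?case
    by (intro combination.zero) simp
next
  case (add_term c h A \<alpha>)
  have "combination D (d - \<bar>\<alpha>\<bar>) h"
    using add_term by simp
  from combination.add_term[OF this add_term.hyps(2), of \<alpha>] show ?case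
    by simp
qed

lemma combination_add:
  assumes "combination D c h" "combination D d k"
  shows "combination D (c + d) (\<lambda>x. h x + k x)"
  using assms(2)
proof (induction rule: combination.induct)
  case (zero d)
  then show ?case
    using assms(1) by (simp add: combination_mono)
next
  case (add_term d k A \<alpha>)
  from combination.add_term[OF add_term.IH add_term.hyps(2), of \<alpha>] show ?case
    by (simp add: add.assoc)
qed

lemma combination_scale:
  "combination D c h \<Longrightarrow> combination D (\<bar>a\<bar> * c) (\<lambda>x. a * h x)"
proof (induction rule: combination.induct)
  case (zero c)
  then show ?case
    by (simp add: combination.zero)
next
  case (add_term c h A \<alpha>)
  from combination.add_term[OF add_term.IH add_term.hyps(2), of "a * \<alpha>"] show ?case
    by (simp add: algebra_simps abs_mult)
qed

lemma combination_mult_indicator: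
  assumes Int: "\<And>A B. A \<in> D \<Longrightarrow> B \<in> D \<Longrightarrow> A \<inter> B \<in> D"
  shows "combination D c h \<Longrightarrow> B \<in> D \<Longrightarrow> combination D c (\<lambda>x. h x * indicator B x)"
proof (induction rule: combination.induct)
  case (zero c)
  then show ?case
    by (simp add: combination.zero)
next
  case (add_term c h A \<alpha>)
  from combination.add_term[OF add_term.IH Int[OF add_term.hyps(2)], of B \<alpha>] show ?case
    using add_term.prems by (simp add: algebra_simps indicator_inter_arith)
qed

lemma combination_mult:
  assumes Int: "\<And>A B. A \<in> D \<Longrightarrow> B \<in> D \<Longrightarrow> A \<inter> B \<in> D"
    and "combination D c h" "combination D d k"
  shows "combination D (c * d) (\<lambda>x. h x * k x)"
  using assms(3)
proof (induction rule: combination.induct)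
  case (zero d)
  then show ?case
    using combination_cost_nonneg[OF assms(2)] by (simp add: combination.zero)
next
  case (add_term d k A \<alpha>)
  have "combination D (\<bar>\<alpha>\<bar> * c) (\<lambda>x. \<alpha> * (h x * indicator A x))"
    using Int assms(2) add_term.hyps(2)
    by (intro combination_scale combination_mult_indicator) auto
  from combination_add[OF add_term.IH this] show ?case
    by (simp add: algebra_simps)
qed

lemma combination_as_sum:
  assumes "combination D c h"
  shows "\<exists>(m::nat) \<alpha> A. (\<forall>i<m. A i \<in> D) \<and> h = (\<lambda>x. \<Sum>i<m. \<alpha> i * indicator (A i) x) \<and>
           (\<Sum>i<m. \<bar>\<alpha> i\<bar>) \<le> c"
  using assms
proof (induction rule: combination.induct)
  case (zero c)
  then show ?case
    by (intro exI[of _ 0]) auto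
next
  case (add_term c h B \<beta>)
  then obtain m :: nat and \<alpha> A where *: "\<forall>i<m. A i \<in> D"
    "h = (\<lambda>x. \<Sum>i<m. \<alpha> i * indicator (A i) x)" "(\<Sum>i<m. \<bar>\<alpha> i\<bar>) \<le> c"
    by blast
  show ?case
    using * add_term.hyps
    by (intro exI[of _ "Suc m"] exI[of _ "\<alpha>(m := \<beta>)"] exI[of _ "A(m := B)"])
       (auto simp: less_Suc_eq)
qed


section \<open>Approximation up to a constant\<close>

definition near :: "(real^'n) set set \<Rightarrow> (real^'n \<Rightarrow> real) \<Rightarrow> real \<Rightarrow> real \<Rightarrow> bool" where
  "near D f c e \<longleftrightarrow>
     (\<exists>a h. combination D c h \<and> (\<forall>x\<in>unit_cube. \<bar>f x - (a + h x)\<bar> \<le> e))"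

text \<open>
  The slack in the cost absorbs both the infimum over representations and the limit inferior
  along approximating sequences.
\<close>

definition variation_at_most ::
    "(real^'n) set set \<Rightarrow> (real^'n \<Rightarrow> real) \<Rightarrow> real \<Rightarrow> bool" where
  "variation_at_most D f c \<longleftrightarrow> (\<forall>e>0. near D f (c + e) e)"

lemma near_mono: "near D f c e \<Longrightarrow> c \<le> c' \<Longrightarrow> e \<le> e' \<Longrightarrow> near D f c' e'"
  unfolding near_def by (meson combination_mono order_trans)

lemma near_perturb:
  assumes "near D g c e" "\<forall>x\<in>unit_cube. \<bar>f x - g x\<bar> \<le> e'"
  shows "near D f c (e + e')"
proof -
  obtain a h where *: "combination D c h" "\<forall>x\<in>unit_cube. \<bar>g x - (a + h x)\<bar> \<le> e"
    using assms(1) by (auto simp: near_def)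
  have "\<bar>f x - (a + h x)\<bar> \<le> e + e'" if "x \<in> unit_cube" for x
    using *(2) assms(2) that by fastforce
  then show ?thesis
    using *(1) by (auto simp: near_def)
qed

lemma near_add:
  assumes "near D f c e" "near D g d e'"
  shows "near D (\<lambda>x. f x + g x) (c + d) (e + e')"
proof -
  obtain a h where f: "combination D c h" "\<forall>x\<in>unit_cube. \<bar>f x - (a + h x)\<bar> \<le> e"
    using assms(1) by (auto simp: near_def)
  obtain b k where g: "combination D d k" "\<forall>x\<in>unit_cube. \<bar>g x - (b + k x)\<bar> \<le> e'"
    using assms(2) by (auto simp: near_def)
  have "\<bar>f x + g x - ((a + b) + (h x + k x))\<bar> \<le> e + e'" if "x \<in> unit_cube" for x
  proof -
    have "\<bar>f x - (a + h x)\<bar> \<le> e" "\<bar>g x - (b + k x)\<bar> \<le> e'"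
      using f g that by auto
    then show ?thesis
      by linarith
  qed
  then show ?thesis
    using combination_add[OF f(1) g(1)] unfolding near_def by blast
qed

lemma near_scale:
  assumes "near D f c e"
  shows "near D (\<lambda>x. a * f x) (\<bar>a\<bar> * c) (\<bar>a\<bar> * e)"
proof -
  obtain b h where f: "combination D c h" "\<forall>x\<in>unit_cube. \<bar>f x - (b + h x)\<bar> \<le> e"
    using assms by (auto simp: near_def)
  have "\<bar>a * f x - (a * b + a * h x)\<bar> \<le> \<bar>a\<bar> * e" if "x \<in> unit_cube" for x
  proof -
    have "a * f x - (a * b + a * h x) = a * (f x - (b + h x))"
      by (simp add: algebra_simps)
    then show ?thesis
      using f that by (simp add: abs_mult mult_left_mono)
  qed
  then show ?thesis
    using combination_scale[OF f(1), of a] unfolding near_def by blast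
qed

lemma unit_cube_nonempty: "(0::real^'n) \<in> unit_cube"
  unfolding unit_cube_def by (simp add: mem_box_cart)

text \<open>
  The constant term \<open>a\<close> of an approximation \<open>a + h\<close> of \<open>f\<close> satisfies \<open>\<bar>a\<bar> \<le> s + c + e\<close>, as one sees
  at any point of the cube. This explains the coefficients of \<open>d\<close> and \<open>c\<close> in the cost: they are
  the bounds for the constants by which the combinations \<open>k\<close> and \<open>h\<close> get multiplied.
\<close>

lemma near_mult:
  assumes Int: "\<And>A B. A \<in> D \<Longrightarrow> B \<in> D \<Longrightarrow> A \<inter> B \<in> D"
    and "near D f c e" "near D g d e'"
    and s: "\<forall>x\<in>unit_cube. \<bar>f x\<bar> \<le> s" and t: "\<forall>x\<in>unit_cube. \<bar>g x\<bar> \<le> t"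
  shows "near D (\<lambda>x. f x * g x)
           ((s + c + e) * d + (t + d + e') * c + c * d) (s * e' + (t + e') * e)"
proof -
  obtain a h where f: "combination D c h" "\<forall>x\<in>unit_cube. \<bar>f x - (a + h x)\<bar> \<le> e"
    using assms(2) by (auto simp: near_def)
  obtain b k where g: "combination D d k" "\<forall>x\<in>unit_cube. \<bar>g x - (b + k x)\<bar> \<le> e'"
    using assms(3) by (auto simp: near_def)
  have a: "\<bar>a\<bar> \<le> s + c + e"
    using bspec[OF f(2) unit_cube_nonempty] bspec[OF s unit_cube_nonempty]
      combination_bound[OF f(1), of 0] by linarith
  have b: "\<bar>b\<bar> \<le> t + d + e'"
    using bspec[OF g(2) unit_cube_nonempty] bspec[OF t unit_cube_nonempty]
      combination_bound[OF g(1), of 0] by linarith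
  have cd: "0 \<le> c" "0 \<le> d"
    using combination_cost_nonneg[OF f(1)] combination_cost_nonneg[OF g(1)] by simp_all
  have comb: "combination D (\<bar>a\<bar> * d + \<bar>b\<bar> * c + c * d) (\<lambda>x. a * k x + b * h x + h x * k x)"
    by (intro combination_add combination_scale combination_mult Int f g)
  have cost: "\<bar>a\<bar> * d + \<bar>b\<bar> * c + c * d \<le> (s + c + e) * d + (t + d + e') * c + c * d"
    using a b cd by (intro add_mono mult_right_mono) auto
  have "\<bar>f x * g x - (a * b + (a * k x + b * h x + h x * k x))\<bar> \<le> s * e' + (t + e') * e"
    if x: "x \<in> unit_cube" for x
  proof -
    have split: "f x * g x - (a * b + (a * k x + b * h x + h x * k x)) =
        f x * (g x - (b + k x)) + (b + k x) * (f x - (a + h x))"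
      by (simp add: algebra_simps)
    have bounds: "\<bar>f x\<bar> \<le> s" "\<bar>g x - (b + k x)\<bar> \<le> e'" "\<bar>b + k x\<bar> \<le> t + e'"
      "\<bar>f x - (a + h x)\<bar> \<le> e"
      using bspec[OF f(2) x] bspec[OF g(2) x] bspec[OF s x] bspec[OF t x] by linarith+
    have "\<bar>f x * (g x - (b + k x))\<bar> \<le> s * e'" "\<bar>(b + k x) * (f x - (a + h x))\<bar> \<le> (t + e') * e"
      unfolding abs_mult using bounds by (intro mult_mono; linarith)+
    then show ?thesis
      unfolding split by linarith
  qed
  then show ?thesis
    using combination_mono[OF comb cost] unfolding near_def by blast
qed

lemma variation_at_most_mono:
  "variation_at_most D f c \<Longrightarrow> c \<le> d \<Longrightarrow> variation_at_most D f d"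
  unfolding variation_at_most_def by (meson add_right_mono near_mono order_refl)

text \<open>
  Estimates for sums and products come with costs and errors that depend on the accuracy \<open>e\<close>; only
  their limits for \<open>e\<close> tending to \<open>0\<close> matter.
\<close>

lemma variation_at_most_limitI:
  fixes C E :: "real \<Rightarrow> real"
  assumes "\<And>e. 0 < e \<Longrightarrow> near D f (C e) (E e)"
    and "(C \<longlongrightarrow> c) (at_right 0)" "(E \<longlongrightarrow> 0) (at_right 0)"
  shows "variation_at_most D f c"
  unfolding variation_at_most_def
proof (intro allI impI)
  fix e :: real assume "e > 0"
  then have "\<forall>\<^sub>F \<delta> in at_right 0. C \<delta> < c + e" "\<forall>\<^sub>F \<delta> in at_right 0. E \<delta> < e"
    using assms(2,3) by (auto intro: order_tendstoD)
  from eventually_happens'[OF trivial_limit_at_right_real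
      eventually_conj[OF this(1) eventually_conj[OF this(2) eventually_at_right_less]]]
  obtain \<delta> where "C \<delta> < c + e" "E \<delta> < e" "0 < \<delta>"
    by blast
  then show "near D f (c + e) e"
    using assms(1)[of \<delta>] near_mono by fastforce
qed

lemma variation_at_most_add:
  assumes "variation_at_most D f c" "variation_at_most D g d"
  shows "variation_at_most D (\<lambda>x. f x + g x) (c + d)"
proof (rule variation_at_most_limitI)
  show "near D (\<lambda>x. f x + g x) ((c + e) + (d + e)) (e + e)" if "0 < e" for e
    using assms that unfolding variation_at_most_def by (intro near_add) auto
qed (auto intro!: tendsto_eq_intros)

lemma variation_at_most_scale:
  assumes "variation_at_most D f c"
  shows "variation_at_most D (\<lambda>x. a * f x) (\<bar>a\<bar> * c)"
proof (rule variation_at_most_limitI)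
  show "near D (\<lambda>x. a * f x) (\<bar>a\<bar> * (c + e)) (\<bar>a\<bar> * e)" if "0 < e" for e
    using assms that unfolding variation_at_most_def by (intro near_scale) auto
qed (auto intro!: tendsto_eq_intros)

lemma variation_at_most_mult:
  assumes Int: "\<And>A B. A \<in> D \<Longrightarrow> B \<in> D \<Longrightarrow> A \<inter> B \<in> D"
    and "variation_at_most D f c" "variation_at_most D g d"
    and s: "\<forall>x\<in>unit_cube. \<bar>f x\<bar> \<le> s" and t: "\<forall>x\<in>unit_cube. \<bar>g x\<bar> \<le> t"
  shows "variation_at_most D (\<lambda>x. f x * g x) (s * d + t * c + 3 * c * d)"
proof (rule variation_at_most_limitI)
  show "near D (\<lambda>x. f x * g x)
      ((s + (c + e) + e) * (d + e) + (t + (d + e) + e) * (c + e) + (c + e) * (d + e))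
      (s * e + (t + e) * e)" if "0 < e" for e
    using assms that unfolding variation_at_most_def by (intro near_mult) auto
qed (auto intro!: tendsto_eq_intros simp: algebra_simps)

text \<open>
  A good approximation of a function uniformly close to \<open>f\<close> is a good approximation of \<open>f\<close> at the
  same cost. This is the lower semicontinuity of the variation under uniform limits.
\<close>

lemma variation_at_most_lsc:
  assumes "\<And>\<delta>. 0 < \<delta> \<Longrightarrow> \<exists>g. variation_at_most D g c \<and> (\<forall>x\<in>unit_cube. \<bar>f x - g x\<bar> \<le> \<delta>)"
  shows "variation_at_most D f c"
proof (rule variation_at_most_limitI)
  show "near D f (c + \<delta>) (\<delta> + \<delta>)" if "0 < \<delta>" for \<delta>
    using assms[OF that] that unfolding variation_at_most_def by (blast intro: near_perturb)
qed (auto intro!: tendsto_eq_intros)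


section \<open>The supremum norm\<close>

lemma sup_norm_nonneg: "0 \<le> sup_norm f"
  unfolding sup_norm_def by (rule SUP_upper2[OF unit_cube_nonempty]) simp

lemma sup_norm_le_iff: "sup_norm f \<le> ereal b \<longleftrightarrow> (\<forall>x\<in>unit_cube. \<bar>f x\<bar> \<le> b)"
  unfolding sup_norm_def by (simp add: SUP_le_iff)

lemma sup_norm_bounded:
  assumes "\<forall>x\<in>unit_cube. \<bar>f x\<bar> \<le> b"
  shows "real_of_ereal (sup_norm f) \<le> b"
    and "\<forall>x\<in>unit_cube. \<bar>f x\<bar> \<le> real_of_ereal (sup_norm f)"
proof -
  obtain s where s: "sup_norm f = ereal s"
    using assms sup_norm_nonneg[of f] unfolding sup_norm_le_iff[symmetric]
    by (cases "sup_norm f") auto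
  show "real_of_ereal (sup_norm f) \<le> b"
    using assms s unfolding sup_norm_le_iff[symmetric] by simp
  show "\<forall>x\<in>unit_cube. \<bar>f x\<bar> \<le> real_of_ereal (sup_norm f)"
    using sup_norm_le_iff[of f s] s by simp
qed


section \<open>The variation in terms of approximations\<close>

text \<open>
  A nonempty set needs at least one term, and a proper nonempty member of the family is its own
  representation with one term.
\<close>

lemma harman_complexity_member:
  assumes "A \<in> D" "D \<subseteq> Pow unit_cube"
  shows "harman_complexity D A = (if A = {} \<or> A = unit_cube then 0 else 1)"
proof (cases "A = {} \<or> A = unit_cube")
  case False
  let ?P = "\<lambda>m. \<exists>n\<le>m. \<exists>B :: nat \<Rightarrow> (real^'a) set.
        (\<forall>i<m. B i \<subseteq> unit_cube \<and> (B i \<in> D \<or> unit_cube - B i \<in> D)) \<and>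
        (indicator A :: real^'a \<Rightarrow> real) =
          (\<lambda>x. (\<Sum>i<n. indicator (B i) x) - (\<Sum>i=n..<m. indicator (B i) x))"
  have "?P 1"
    using assms by (intro exI[of _ 1] conjI exI[of _ "\<lambda>_. A"]) auto
  moreover have "\<not> ?P 0"
  proof
    assume "?P 0"
    then have "(indicator A :: real^'a \<Rightarrow> real) = (\<lambda>x. 0)"
      by auto
    then have "A = {}"
      by (metis ex_in_conv indicator_simps(1) zero_neq_one)
    then show False
      using False by simp
  qed
  ultimately have "(LEAST m. ?P m) = 1"
    by (intro Least_equality) (auto simp: Suc_le_eq intro: Nat.gr0I)
  then show ?thesis
    using False unfolding harman_complexity_def by simp
qed (simp add: harman_complexity_def)

text \<open>The occurrences of the whole cube in a sum are collected in the constant \<open>a\<close>.\<close>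

lemma sum_as_combination:
  fixes A :: "nat \<Rightarrow> (real^'n) set"
  assumes "D \<subseteq> Pow unit_cube" "\<forall>i<m. A i \<in> D"
  shows "\<exists>a h. combination D (\<Sum>i<m. \<bar>\<alpha> i\<bar> * real (harman_complexity D (A i))) h \<and>
           (\<forall>x\<in>unit_cube. (\<Sum>i<m. \<alpha> i * indicator (A i) x) = a + h x)"
  using assms(2)
proof (induction m)
  case 0
  show ?case
    by (intro exI[of _ 0] exI[of _ "\<lambda>x. 0"]) (simp add: combination.zero)
next
  case (Suc m)
  then obtain a h where
    IH: "combination D (\<Sum>i<m. \<bar>\<alpha> i\<bar> * real (harman_complexity D (A i))) h"
      "\<forall>x\<in>unit_cube. (\<Sum>i<m. \<alpha> i * indicator (A i) x) = a + h x"
    by auto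
  have A: "A m \<in> D"
    using Suc.prems by simp
  note complexity = harman_complexity_member[OF A assms(1)]
  consider "A m = {}" | "A m = unit_cube" | "A m \<noteq> {}" "A m \<noteq> unit_cube"
    by blast
  then show ?case
  proof cases
    case 1
    then show ?thesis
      using IH complexity by (intro exI[of _ a] exI[of _ h]) simp
  next
    case 2
    then show ?thesis
      using IH complexity by (intro exI[of _ "a + \<alpha> m"] exI[of _ h]) simp
  next
    case 3
    then show ?thesis
      using IH complexity combination.add_term[OF IH(1) A, of "\<alpha> m"]
      by (intro exI[of _ a] exI[of _ "\<lambda>x. h x + \<alpha> m * indicator (A m) x"]) simp
  qed
qed

lemma near_if_simple_variation_less:
  assumes "D \<subseteq> Pow unit_cube" "simple_variation D F < ereal c"
    and "sup_norm (\<lambda>x. f x - F x) \<le> ereal e"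
  shows "near D f c e"
proof -
  obtain m :: nat and \<alpha> A where *: "\<forall>i<m. A i \<in> D" "F = (\<lambda>x. \<Sum>i<m. \<alpha> i * indicator (A i) x)"
    "(\<Sum>i<m. \<bar>\<alpha> i\<bar> * real (harman_complexity D (A i))) < c"
    using assms(2) unfolding simple_variation_def Inf_less_iff by auto
  obtain a h where "combination D c h" "\<forall>x\<in>unit_cube. F x = a + h x"
    using sum_as_combination[OF assms(1) *(1), of \<alpha>] *(2,3) combination_mono less_imp_le by metis
  then show ?thesis
    using assms(3) unfolding near_def sup_norm_le_iff by metis
qed

text \<open>
  On the cube the constant \<open>a\<close> is \<open>a\<close> times the indicator of the cube, a term of complexity \<open>0\<close>.
\<close>

lemma simple_approximation_if_near:
  assumes "D \<subseteq> Pow unit_cube" "unit_cube \<in> D" "near D f c e"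
  shows "\<exists>F\<in>simple_functions D. simple_variation D F \<le> ereal c \<and>
           sup_norm (\<lambda>x. f x - F x) \<le> ereal e"
proof -
  obtain a h where "combination D c h" and h: "\<forall>x\<in>unit_cube. \<bar>f x - (a + h x)\<bar> \<le> e"
    using assms(3) unfolding near_def by auto
  then obtain m :: nat and \<alpha> A where A: "\<forall>i<m. A i \<in> D"
    and h_eq: "h = (\<lambda>x. \<Sum>i<m. \<alpha> i * indicator (A i) x)" and cost: "(\<Sum>i<m. \<bar>\<alpha> i\<bar>) \<le> c"
    using combination_as_sum by blast
  define \<alpha>' where "\<alpha>' = \<alpha>(m := a)"
  define A' where "A' = A(m := unit_cube)"
  define F where "F = (\<lambda>x. \<Sum>i<Suc m. \<alpha>' i * indicator (A' i) x)"
  have A': "\<forall>i<Suc m. A' i \<in> D"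
    using A assms(2) by (auto simp: A'_def less_Suc_eq)
  have F_eq: "F x = h x + a * indicator unit_cube x" for x
    by (simp add: F_def \<alpha>'_def A'_def h_eq)
  have "F \<in> simple_functions D"
    using A' F_def unfolding simple_functions_def by blast
  moreover have "simple_variation D F \<le> ereal c"
  proof -
    have "simple_variation D F \<le>
        ereal (\<Sum>i<Suc m. \<bar>\<alpha>' i\<bar> * real (harman_complexity D (A' i)))"
      unfolding simple_variation_def using A' F_def by (intro Inf_lower) blast
    also have "(\<Sum>i<Suc m. \<bar>\<alpha>' i\<bar> * real (harman_complexity D (A' i))) =
        (\<Sum>i<m. \<bar>\<alpha> i\<bar> * real (harman_complexity D (A i)))"
      by (simp add: \<alpha>'_def A'_def harman_complexity_def[of D unit_cube])
    also have "\<dots> \<le> (\<Sum>i<m. \<bar>\<alpha> i\<bar>)"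
      using A harman_complexity_member[OF _ assms(1)] by (intro sum_mono) auto
    finally show ?thesis
      using cost by (meson ereal_less_eq(3) order_trans)
  qed
  moreover have "sup_norm (\<lambda>x. f x - F x) \<le> ereal e"
    using h unfolding sup_norm_le_iff F_eq by (simp add: add.commute)
  ultimately show ?thesis
    by blast
qed

locale intersection_stable_family =
  fixes M :: "(real^'n) measure" and D :: "(real^'n) set set" and \<sigma> :: real
  assumes space_M: "space M = unit_cube"
    and D_sets: "D \<subseteq> sets M"
    and cube_D: "unit_cube \<in> D"
    and Int_D: "\<And>A B. A \<in> D \<Longrightarrow> B \<in> D \<Longrightarrow> A \<inter> B \<in> D"
    and \<sigma>_ge: "3 \<le> \<sigma>"
begin

lemma \<sigma>_nonneg: "0 \<le> \<sigma>" and \<sigma>_pos: "0 < \<sigma>"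
  using \<sigma>_ge by auto

lemma D_subset: "D \<subseteq> Pow unit_cube"
  using subset_trans[OF D_sets sets.space_closed] by (simp add: space_M)

lemma simple_variation_nonneg: "0 \<le> simple_variation D F"
  unfolding simple_variation_def
  by (rule Inf_greatest) (auto intro!: sum_nonneg simp del: sum_ereal)

lemma variation_nonneg: "0 \<le> variation M D f"
proof (cases "f \<in> uniform_limits M D")
  case True
  then show ?thesis
    unfolding variation_def if_P[OF True]
    by (intro Inf_greatest)
       (auto intro: Liminf_bounded[OF always_eventually[OF allI[OF simple_variation_nonneg]]])
qed (simp add: variation_def)

text \<open>
  If the limit inferior along an approximating sequence is below \<open>v + e\<close>, then infinitely many
  members have variation below \<open>v + e\<close>, and almost all of these are within \<open>e\<close> of \<open>f\<close>.
\<close>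

lemma variation_finite:
  assumes "f \<in> bounded_variation M D"
  obtains v where "0 \<le> v" "variation M D f = ereal v" "variation_at_most D f v"
proof -
  have f: "f \<in> uniform_limits M D" "variation M D f < \<infinity>"
    using assms by (auto simp: bounded_variation_def)
  obtain v where v: "variation M D f = ereal v"
    using f(2) variation_nonneg[of f] by (cases "variation M D f") auto
  have "near D f (v + e) e" if "0 < e" for e
  proof -
    have "variation M D f < ereal (v + e)"
      using v that by simp
    then obtain F :: "nat \<Rightarrow> real^'n \<Rightarrow> real" where
      F: "liminf (\<lambda>i. simple_variation D (F i)) < ereal (v + e)"
        "(\<lambda>i. sup_norm (\<lambda>x. f x - F i x)) \<longlonglongrightarrow> 0"
      using f(1) unfolding variation_def by (auto simp: Inf_less_iff)
    have "\<forall>\<^sub>F i in sequentially. sup_norm (\<lambda>x. f x - F i x) < ereal e"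
      using F(2) that by (auto intro: order_tendstoD)
    moreover have "\<exists>\<^sub>F i in sequentially. simple_variation D (F i) < ereal (v + e)"
      using F(1) Liminf_bounded[of "ereal (v + e)" "\<lambda>i. simple_variation D (F i)" sequentially]
      unfolding frequently_def by (auto simp: not_less)
    ultimately have "\<exists>\<^sub>F i in sequentially.
        simple_variation D (F i) < ereal (v + e) \<and> sup_norm (\<lambda>x. f x - F i x) < ereal e"
      using frequently_eventually_frequently by blast
    then obtain i where
      "simple_variation D (F i) < ereal (v + e)" "sup_norm (\<lambda>x. f x - F i x) < ereal e"
      using frequently_ex by blast
    then show ?thesis
      using near_if_simple_variation_less[OF D_subset] less_imp_le by blast
  qed
  moreover have "0 \<le> v"
    using v variation_nonneg[of f] by simp
  ultimately show ?thesis
    using that v unfolding variation_at_most_def by blast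
qed

text \<open>
  Conversely, approximations of accuracy \<open>1 / (i + 1)\<close> form a sequence that is admissible in the
  definition of the variation.
\<close>

lemma variation_leI:
  assumes meas: "f \<in> borel_measurable M" and outside: "\<forall>x. x \<notin> unit_cube \<longrightarrow> f x = 0"
    and "variation_at_most D f c"
  shows "f \<in> bounded_variation M D" "real_of_ereal (variation M D f) \<le> c"
proof -
  have "near D f (c + 1 / real (Suc i)) (1 / real (Suc i))" for i
    using assms(3) unfolding variation_at_most_def by (simp del: of_nat_Suc)
  then have "\<forall>i. \<exists>F. F \<in> simple_functions D \<and> simple_variation D F \<le> ereal (c + 1 / real (Suc i)) \<and>
           sup_norm (\<lambda>x. f x - F x) \<le> ereal (1 / real (Suc i))"
    using simple_approximation_if_near[OF D_subset cube_D] by blast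
  from choice[OF this] obtain F where F: "\<And>i. F i \<in> simple_functions D"
    "\<And>i. simple_variation D (F i) \<le> ereal (c + 1 / real (Suc i))"
    "\<And>i. sup_norm (\<lambda>x. f x - F i x) \<le> ereal (1 / real (Suc i))"
    by blast
  have inverse_lim: "(\<lambda>i. 1 / real (Suc i)) \<longlonglongrightarrow> 0"
    using LIMSEQ_inverse_real_of_nat unfolding inverse_eq_divide .
  have lim: "(\<lambda>i. sup_norm (\<lambda>x. f x - F i x)) \<longlonglongrightarrow> 0"
  proof (rule tendsto_sandwich[OF _ _ tendsto_const])
    show "\<forall>\<^sub>F i in sequentially. 0 \<le> sup_norm (\<lambda>x. f x - F i x)"
      by (rule always_eventually[OF allI[OF sup_norm_nonneg]])
    show "\<forall>\<^sub>F i in sequentially. sup_norm (\<lambda>x. f x - F i x) \<le> ereal (1 / real (Suc i))"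
      by (rule always_eventually[OF allI[OF F(3)]])
    show "(\<lambda>i. ereal (1 / real (Suc i))) \<longlonglongrightarrow> 0"
      by (rule tendsto_ereal[OF inverse_lim, folded zero_ereal_def])
  qed
  have mem: "f \<in> uniform_limits M D"
    using meas outside F(1) lim unfolding uniform_limits_def by blast
  have "(\<lambda>i. c + 1 / real (Suc i)) \<longlonglongrightarrow> c"
    using tendsto_add[OF tendsto_const inverse_lim, of c] by simp
  then have "(\<lambda>i. ereal (c + 1 / real (Suc i))) \<longlonglongrightarrow> ereal c"
    by (rule tendsto_ereal)
  then have "liminf (\<lambda>i. ereal (c + 1 / real (Suc i))) = ereal c"
    by (intro lim_imp_Liminf) simp_all
  moreover have "liminf (\<lambda>i. simple_variation D (F i)) \<le> liminf (\<lambda>i. ereal (c + 1 / real (Suc i)))"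
    by (rule Liminf_mono[OF always_eventually[OF allI[OF F(2)]]])
  moreover have "variation M D f \<le> liminf (\<lambda>i. simple_variation D (F i))"
    using mem F(1) lim unfolding variation_def if_P[OF mem] by (intro Inf_lower) blast
  ultimately have le: "variation M D f \<le> ereal c"
    by simp
  then show "f \<in> bounded_variation M D"
    using mem unfolding bounded_variation_def by auto
  show "real_of_ereal (variation M D f) \<le> c"
    using le variation_nonneg[of f] by (cases "variation M D f") auto
qed


section \<open>The algebra of functions of bounded variation\<close>

lemma bounded_variationD:
  assumes "f \<in> bounded_variation M D"
  shows "f \<in> borel_measurable M" "\<And>x. x \<notin> unit_cube \<Longrightarrow> f x = 0"
    and "\<forall>x\<in>unit_cube. \<bar>f x\<bar> \<le> real_of_ereal (sup_norm f)"
    and "variation_at_most D f (real_of_ereal (variation M D f))"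
proof -
  show "f \<in> borel_measurable M" "\<And>x. x \<notin> unit_cube \<Longrightarrow> f x = 0"
    using assms unfolding bounded_variation_def uniform_limits_def by blast+
  obtain v where v: "variation M D f = ereal v" "variation_at_most D f v"
    using assms by (rule variation_finite)
  then show "variation_at_most D f (real_of_ereal (variation M D f))"
    by simp
  have "near D f (v + 1) 1"
    using v(2) zero_less_one unfolding variation_at_most_def by blast
  then obtain a h where h: "combination D (v + 1) h" "\<forall>x\<in>unit_cube. \<bar>f x - (a + h x)\<bar> \<le> 1"
    unfolding near_def by blast
  have "\<bar>f x\<bar> \<le> \<bar>a\<bar> + (v + 1) + 1" if "x \<in> unit_cube" for x
    using bspec[OF h(2) that] combination_bound[OF h(1), of x] by linarith
  then show "\<forall>x\<in>unit_cube. \<bar>f x\<bar> \<le> real_of_ereal (sup_norm f)"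
    by (rule sup_norm_bounded(2)[OF ballI])
qed

lemma sup_norm_real_nonneg: "0 \<le> real_of_ereal (sup_norm f)"
  by (rule real_of_ereal_pos[OF sup_norm_nonneg])

lemma variation_real_nonneg: "0 \<le> real_of_ereal (variation M D f)"
  by (rule real_of_ereal_pos[OF variation_nonneg])

lemma variation_norm_nonneg: "0 \<le> variation_norm \<sigma> M D f"
  unfolding variation_norm_def by (simp add: sup_norm_real_nonneg variation_real_nonneg \<sigma>_nonneg)

lemma variation_norm_leI:
  assumes "f \<in> borel_measurable M" "\<And>x. x \<notin> unit_cube \<Longrightarrow> f x = 0"
    and "\<forall>x\<in>unit_cube. \<bar>f x\<bar> \<le> s" "variation_at_most D f c"
  shows "f \<in> bounded_variation M D" "variation_norm \<sigma> M D f \<le> s + \<sigma> * c"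
proof -
  show "f \<in> bounded_variation M D"
    using assms(2) by (intro variation_leI(1)[OF assms(1) _ assms(4)]) simp
  have "real_of_ereal (variation M D f) \<le> c"
    using assms(2) by (intro variation_leI(2)[OF assms(1) _ assms(4)]) simp
  then show "variation_norm \<sigma> M D f \<le> s + \<sigma> * c"
    unfolding variation_norm_def
    using sup_norm_bounded(1)[OF assms(3)] \<sigma>_nonneg by (intro add_mono mult_left_mono)
qed

lemma zero_bounded_variation:
  shows "(\<lambda>x. 0) \<in> bounded_variation M D" "variation_norm \<sigma> M D (\<lambda>x. 0) = 0"
proof -
  have zero: "variation_at_most D (\<lambda>x. 0) 0"
    unfolding variation_at_most_def near_def
    by (intro allI impI exI[of _ 0] exI[of _ "\<lambda>x. 0"]) (simp add: combination.zero)
  show "(\<lambda>x. 0) \<in> bounded_variation M D"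
    using variation_leI(1)[OF _ _ zero] by simp
  show "variation_norm \<sigma> M D (\<lambda>x. 0) = 0"
    using variation_norm_leI(2)[OF _ _ _ zero, of 0] variation_norm_nonneg[of "\<lambda>x. 0"]
    by (simp add: antisym)
qed

lemma add_bounded_variation:
  assumes "f \<in> bounded_variation M D" "g \<in> bounded_variation M D"
  shows "(\<lambda>x. f x + g x) \<in> bounded_variation M D"
    and "variation_norm \<sigma> M D (\<lambda>x. f x + g x) \<le> variation_norm \<sigma> M D f + variation_norm \<sigma> M D g"
proof -
  note f = bounded_variationD[OF assms(1)] and g = bounded_variationD[OF assms(2)]
  have "\<forall>x\<in>unit_cube. \<bar>f x + g x\<bar> \<le> real_of_ereal (sup_norm f) + real_of_ereal (sup_norm g)"
    using f(3) g(3) by (meson abs_triangle_ineq add_mono order_trans)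
  note * = variation_norm_leI[OF _ _ this variation_at_most_add[OF f(4) g(4)]]
  show "(\<lambda>x. f x + g x) \<in> bounded_variation M D"
    using f(1,2) g(1,2) by (intro *) auto
  show "variation_norm \<sigma> M D (\<lambda>x. f x + g x) \<le> variation_norm \<sigma> M D f + variation_norm \<sigma> M D g"
    using *(2) f(1,2) g(1,2) by (simp add: variation_norm_def algebra_simps)
qed

lemma scale_bounded_variation:
  assumes "f \<in> bounded_variation M D"
  shows "(\<lambda>x. a * f x) \<in> bounded_variation M D"
    and "variation_norm \<sigma> M D (\<lambda>x. a * f x) = \<bar>a\<bar> * variation_norm \<sigma> M D f"
proof -
  have scale: "(\<lambda>x. a * f x) \<in> bounded_variation M D \<and>
      variation_norm \<sigma> M D (\<lambda>x. a * f x) \<le> \<bar>a\<bar> * variation_norm \<sigma> M D f"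
    if "f \<in> bounded_variation M D" for a f
  proof -
    note f = bounded_variationD[OF that]
    have "\<forall>x\<in>unit_cube. \<bar>a * f x\<bar> \<le> \<bar>a\<bar> * real_of_ereal (sup_norm f)"
      using f(3) by (simp add: abs_mult mult_left_mono)
    note * = variation_norm_leI[OF _ _ this variation_at_most_scale[OF f(4), of a]]
    have "(\<lambda>x. a * f x) \<in> bounded_variation M D"
      using f(1,2) by (intro *) auto
    moreover have "variation_norm \<sigma> M D (\<lambda>x. a * f x) \<le> \<bar>a\<bar> * variation_norm \<sigma> M D f"
      using *(2) f(1,2) by (simp add: variation_norm_def algebra_simps)
    ultimately show ?thesis
      by blast
  qed
  show mem: "(\<lambda>x. a * f x) \<in> bounded_variation M D"
    using scale[OF assms] by blast
  show "variation_norm \<sigma> M D (\<lambda>x. a * f x) = \<bar>a\<bar> * variation_norm \<sigma> M D f"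
  proof (cases "a = 0")
    case True
    then show ?thesis
      using zero_bounded_variation(2) by simp
  next
    case False
    (* the reverse inequality is the same estimate for scaling back by 1/a *)
    have "variation_norm \<sigma> M D f \<le> \<bar>inverse a\<bar> * variation_norm \<sigma> M D (\<lambda>x. a * f x)"
      using scale[OF mem, of "inverse a"] False by (simp add: mult.assoc[symmetric])
    then have "\<bar>a\<bar> * variation_norm \<sigma> M D f \<le> variation_norm \<sigma> M D (\<lambda>x. a * f x)"
      using False by (simp add: field_simps)
    then show ?thesis
      using scale[OF assms, of a] by (simp add: antisym)
  qed
qed

lemma mult_bounded_variation:
  assumes "f \<in> bounded_variation M D" "g \<in> bounded_variation M D"
  shows "(\<lambda>x. f x * g x) \<in> bounded_variation M D"
    and "variation_norm \<sigma> M D (\<lambda>x. f x * g x) \<le> variation_norm \<sigma> M D f * variation_norm \<sigma> M D g"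
proof -
  note f = bounded_variationD[OF assms(1)] and g = bounded_variationD[OF assms(2)]
  define s where "s = real_of_ereal (sup_norm f)"
  define t where "t = real_of_ereal (sup_norm g)"
  define v where "v = real_of_ereal (variation M D f)"
  define w where "w = real_of_ereal (variation M D g)"
  have sup: "\<forall>x\<in>unit_cube. \<bar>f x * g x\<bar> \<le> s * t"
    using f(3) g(3) unfolding abs_mult s_def t_def
    by (auto intro!: mult_mono sup_norm_real_nonneg)
  have var: "variation_at_most D (\<lambda>x. f x * g x) (s * w + t * v + 3 * v * w)"
    unfolding s_def t_def v_def w_def
    by (rule variation_at_most_mult[OF Int_D f(4) g(4) f(3) g(3)])
  have meas: "(\<lambda>x. f x * g x) \<in> borel_measurable M"
    using f(1) g(1) by auto
  note * = variation_norm_leI[OF meas _ sup var]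
  show "(\<lambda>x. f x * g x) \<in> bounded_variation M D"
    using f(2) by (intro *) auto
  (* this is where 3 <= sigma enters *)
  have "(3 * \<sigma>) * (v * w) \<le> (\<sigma> * \<sigma>) * (v * w)"
    using \<sigma>_ge unfolding v_def w_def
    by (intro mult_right_mono mult_nonneg_nonneg variation_real_nonneg) auto
  then have "s * t + \<sigma> * (s * w + t * v + 3 * v * w) \<le> (s + \<sigma> * v) * (t + \<sigma> * w)"
    by (simp add: algebra_simps)
  then show "variation_norm \<sigma> M D (\<lambda>x. f x * g x) \<le> variation_norm \<sigma> M D f * variation_norm \<sigma> M D g"
    using *(2) f(2) by (simp add: variation_norm_def s_def t_def v_def w_def)
qed

lemma sup_le_variation_norm:
  assumes "f \<in> bounded_variation M D"
  shows "\<bar>f x\<bar> \<le> variation_norm \<sigma> M D f"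
proof (cases "x \<in> unit_cube")
  case True
  have "0 \<le> \<sigma> * real_of_ereal (variation M D f)"
    using \<sigma>_nonneg variation_real_nonneg by simp
  then show ?thesis
    using bspec[OF bounded_variationD(3)[OF assms] True] unfolding variation_norm_def by linarith
next
  case False
  then show ?thesis
    using bounded_variationD(2)[OF assms] variation_norm_nonneg by simp
qed

lemma variation_at_most_norm:
  assumes "f \<in> bounded_variation M D" "variation_norm \<sigma> M D f \<le> e"
  shows "variation_at_most D f (e / \<sigma>)"
proof (rule variation_at_most_mono[OF bounded_variationD(4)[OF assms(1)]])
  have "\<sigma> * real_of_ereal (variation M D f) \<le> e"
    using assms(2) sup_norm_real_nonneg[of f] unfolding variation_norm_def by linarith
  then show "real_of_ereal (variation M D f) \<le> e / \<sigma>"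
    using \<sigma>_pos by (simp add: field_simps)
qed

lemma variation_norm_eq_zero_iff:
  assumes "f \<in> bounded_variation M D"
  shows "variation_norm \<sigma> M D f = 0 \<longleftrightarrow> f = (\<lambda>x. 0)"
  using sup_le_variation_norm[OF assms] zero_bounded_variation(2) by fastforce

lemma diff_bounded_variation:
  assumes "f \<in> bounded_variation M D" "g \<in> bounded_variation M D"
  shows "(\<lambda>x. f x - g x) \<in> bounded_variation M D"
  using add_bounded_variation(1)[OF assms(1) scale_bounded_variation(1)[OF assms(2), of "-1"]]
  by simp

text \<open>
  The symmetry axiom of \<^locale>\<open>Metric_space\<close> is not restricted to the carrier, so arbitrary functions
  have to be covered. Outside the space the variation is infinite for both \<open>f\<close> and \<open>- f\<close>.
\<close>

lemma variation_norm_minus: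
  shows "variation_norm \<sigma> M D (\<lambda>x. - f x) = variation_norm \<sigma> M D f"
proof (cases "f \<in> bounded_variation M D")
  case True
  then show ?thesis
    using scale_bounded_variation(2)[of f "-1"] by simp
next
  case False
  then have "(\<lambda>x. - f x) \<notin> bounded_variation M D"
    using scale_bounded_variation(1)[of "\<lambda>x. - f x" "-1"] by auto
  moreover have "variation M D h = \<infinity>" if "h \<notin> bounded_variation M D" for h
    using that unfolding bounded_variation_def variation_def by (auto split: if_splits)
  ultimately show ?thesis
    using False by (simp add: variation_norm_def sup_norm_def)
qed

lemma Metric_space_variation_norm:
  shows "Metric_space (bounded_variation M D) (\<lambda>f g. variation_norm \<sigma> M D (\<lambda>x. f x - g x))"
proof
  fix f g h :: "real^'n \<Rightarrow> real"
  show "0 \<le> variation_norm \<sigma> M D (\<lambda>x. f x - g x)"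
    by (rule variation_norm_nonneg)
  show "variation_norm \<sigma> M D (\<lambda>x. f x - g x) = variation_norm \<sigma> M D (\<lambda>x. g x - f x)"
    using variation_norm_minus[of "\<lambda>x. f x - g x"] by simp
  assume f: "f \<in> bounded_variation M D" and g: "g \<in> bounded_variation M D"
  show "variation_norm \<sigma> M D (\<lambda>x. f x - g x) = 0 \<longleftrightarrow> f = g"
    using variation_norm_eq_zero_iff[OF diff_bounded_variation[OF f g]]
    by (simp add: fun_eq_iff)
  assume h: "h \<in> bounded_variation M D"
  show "variation_norm \<sigma> M D (\<lambda>x. f x - h x)
      \<le> variation_norm \<sigma> M D (\<lambda>x. f x - g x) + variation_norm \<sigma> M D (\<lambda>x. g x - h x)"
    using add_bounded_variation(2)[OF diff_bounded_variation[OF f g]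
        diff_bounded_variation[OF g h]] by simp
qed

text \<open>
  The norm dominates the supremum norm, so a Cauchy sequence \<open>F\<close> converges uniformly to some \<open>f\<close>. For
  large \<open>n\<close>, the differences \<open>F n - F m\<close> converge uniformly to \<open>F n - f\<close> and have small variation, and
  lower semicontinuity transfers the bound to \<open>F n - f\<close>.
\<close>

lemma variation_norm_complete:
  shows "Metric_space.mcomplete (bounded_variation M D)
           (\<lambda>f g. variation_norm \<sigma> M D (\<lambda>x. f x - g x))"
proof -
  interpret Metric_space "bounded_variation M D" "\<lambda>f g. variation_norm \<sigma> M D (\<lambda>x. f x - g x)"
    by (rule Metric_space_variation_norm)
  show ?thesis
    unfolding mcomplete_def
  proof (intro allI impI)
    fix F :: "nat \<Rightarrow> real^'n \<Rightarrow> real"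
    assume "MCauchy F"
    then have mem: "\<And>n. F n \<in> bounded_variation M D"
      and Cauchy_F: "\<And>e. 0 < e \<Longrightarrow> \<exists>N. \<forall>m n. N \<le> m \<longrightarrow> N \<le> n \<longrightarrow>
        variation_norm \<sigma> M D (\<lambda>x. F m x - F n x) < e"
      unfolding MCauchy_def by auto
    note diff_mem = diff_bounded_variation[OF mem mem]
    have sup_diff: "\<bar>F m x - F n x\<bar> \<le> variation_norm \<sigma> M D (\<lambda>x. F m x - F n x)" for m n x
      by (rule sup_le_variation_norm[OF diff_mem])
    have Cauchy_at: "Cauchy (\<lambda>n. F n x)" for x
    proof (rule metric_CauchyI)
      fix e :: real assume "0 < e"
      then obtain N where N: "\<And>m n. N \<le> m \<Longrightarrow> N \<le> n \<Longrightarrow>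
          variation_norm \<sigma> M D (\<lambda>x. F m x - F n x) < e"
        using Cauchy_F by blast
      show "\<exists>N. \<forall>m\<ge>N. \<forall>n\<ge>N. dist (F m x) (F n x) < e"
        unfolding dist_real_def
        by (intro exI[of _ N] allI impI le_less_trans[OF sup_diff N])
    qed
    have "\<forall>x. \<exists>l. (\<lambda>n. F n x) \<longlonglongrightarrow> l"
      using Cauchy_convergent[OF Cauchy_at] unfolding convergent_def by blast
    from choice[OF this] obtain f where lim: "\<And>x. (\<lambda>n. F n x) \<longlonglongrightarrow> f x"
      by blast
    have meas: "f \<in> borel_measurable M"
      by (rule borel_measurable_LIMSEQ_real[OF lim bounded_variationD(1)[OF mem]])
    have outside: "f x = 0" if "x \<notin> unit_cube" for x
      using lim[of x] bounded_variationD(2)[OF mem that] by (simp add: LIMSEQ_const_iff)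
    have close: "\<exists>N. \<forall>n\<ge>N. (\<lambda>x. F n x - f x) \<in> bounded_variation M D \<and>
        variation_norm \<sigma> M D (\<lambda>x. F n x - f x) \<le> e + e" if e: "0 < e" for e
    proof -
      obtain N where N: "\<And>m n. N \<le> m \<Longrightarrow> N \<le> n \<Longrightarrow>
          variation_norm \<sigma> M D (\<lambda>x. F m x - F n x) < e"
        using Cauchy_F[OF e] by blast
      have unif: "\<bar>F n x - f x\<bar> \<le> \<delta>" if "\<And>m. K \<le> m \<Longrightarrow> variation_norm \<sigma> M D (\<lambda>x. F n x - F m x) < \<delta>"
        for K n x \<delta>
      proof (rule LIMSEQ_le_const2)
        show "(\<lambda>m. \<bar>F n x - F m x\<bar>) \<longlonglongrightarrow> \<bar>F n x - f x\<bar>"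
          by (intro tendsto_intros lim)
        show "\<exists>K. \<forall>m\<ge>K. \<bar>F n x - F m x\<bar> \<le> \<delta>"
          by (intro exI[of _ K] allI impI less_imp_le[OF le_less_trans[OF sup_diff that]])
      qed
      have "variation_at_most D (\<lambda>x. F n x - f x) (e / \<sigma>)" if "N \<le> n" for n
      proof (rule variation_at_most_lsc)
        fix \<delta> :: real assume "0 < \<delta>"
        then obtain K where K: "\<And>m n. K \<le> m \<Longrightarrow> K \<le> n \<Longrightarrow>
            variation_norm \<sigma> M D (\<lambda>x. F m x - F n x) < \<delta>"
          using Cauchy_F by blast
        define m where "m = max N K"
        have "variation_at_most D (\<lambda>x. F n x - F m x) (e / \<sigma>)"
          using N[OF that, of m]
          by (intro variation_at_most_norm diff_mem) (auto simp: m_def)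
        moreover have "\<bar>F m x - f x\<bar> \<le> \<delta>" for x
          using K[of m] by (intro unif[of K]) (auto simp: m_def)
        ultimately show "\<exists>g. variation_at_most D g (e / \<sigma>) \<and>
            (\<forall>x\<in>unit_cube. \<bar>F n x - f x - g x\<bar> \<le> \<delta>)"
          by (intro exI[of _ "\<lambda>x. F n x - F m x"]) simp
      qed
      moreover have "\<forall>x\<in>unit_cube. \<bar>F n x - f x\<bar> \<le> e" if "N \<le> n" for n
        by (intro ballI unif[OF N[OF that]])
      moreover have "(\<lambda>x. F n x - f x) \<in> borel_measurable M" for n
        using meas bounded_variationD(1)[OF mem] by auto
      moreover have "F n x - f x = 0" if "x \<notin> unit_cube" for n x
        using outside bounded_variationD(2)[OF mem] that by simp
      ultimately have "(\<lambda>x. F n x - f x) \<in> bounded_variation M D"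
        "variation_norm \<sigma> M D (\<lambda>x. F n x - f x) \<le> e + \<sigma> * (e / \<sigma>)" if "N \<le> n" for n
        using variation_norm_leI[of "\<lambda>x. F n x - f x"] that by blast+
      then show ?thesis
        using \<sigma>_pos by (intro exI[of _ N]) simp
    qed
    obtain n where "(\<lambda>x. F n x - f x) \<in> bounded_variation M D"
      using close[OF zero_less_one] by blast
    from diff_bounded_variation[OF mem[of n] this] have "f \<in> bounded_variation M D"
      by simp
    moreover have "\<exists>N. \<forall>n\<ge>N. F n \<in> bounded_variation M D \<and>
        variation_norm \<sigma> M D (\<lambda>x. F n x - f x) < e" if e: "0 < e" for e
    proof -
      obtain N where N: "\<And>n. N \<le> n \<Longrightarrow> variation_norm \<sigma> M D (\<lambda>x. F n x - f x) \<le> e / 3 + e / 3"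
        using close[of "e / 3"] e by auto
      have "e / 3 + e / 3 < e"
        using e by simp
      then show ?thesis
        using mem le_less_trans[OF N] by blast
    qed
    ultimately show "\<exists>f. limitin mtopology F f sequentially"
      unfolding limit_metric_sequentially by blast
  qed
qed

end

theorem theorem5p3:
  fixes M :: "(real^'n) measure" and D :: "(real^'n) set set" and \<sigma> :: real
  assumes "space M = unit_cube"
    and "D \<subseteq> sets M"
    and "{} \<in> D" and "unit_cube \<in> D"
    and "\<And>A B. A \<in> D \<Longrightarrow> B \<in> D \<Longrightarrow> A \<inter> B \<in> D"
    and "\<sigma> \<ge> 3"
  shows "commutative_banach_algebra (bounded_variation M D)
           (\<lambda>f g x. f x + g x) (\<lambda>x. 0) (\<lambda>a f x. a * f x) (\<lambda>f g x. f x * g x)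
           (variation_norm \<sigma> M D)"
proof -
  interpret intersection_stable_family M D
    by unfold_locales (use assms in auto)
  show ?thesis
  proof
    fix f :: "real^'n \<Rightarrow> real"
    assume f: "f \<in> bounded_variation M D"
    show "\<exists>g\<in>bounded_variation M D. (\<lambda>x. f x + g x) = (\<lambda>x. 0)"
      using scale_bounded_variation(1)[OF f, of "-1"] by (intro bexI) auto
  next
    show "Metric_space.mcomplete (bounded_variation M D)
        (\<lambda>f g. variation_norm \<sigma> M D (\<lambda>x. f x + - 1 * g x))"
      using variation_norm_complete by simp
  qed (auto simp: algebra_simps zero_bounded_variation
      add_bounded_variation scale_bounded_variation mult_bounded_variation
      variation_norm_nonneg variation_norm_eq_zero_iff)
qed

end
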